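(* Let $\Omega\subset\mathbb{R}^n$ be a convex bounded domain, $\overline{\psi}\in L^2(\Omega)$, $w\in L^2(\Omega)$, $\alpha>0$, and $a<b$ real constants. Let $\mathcal{E}:L^2(\Omega)\to L^2(\Omega)$ be a bounded linear operator with adjoint $\mathcal{E}^*$, and assume there is at least one $q\in L^2(\Omega)$ with $a\le\langle w,\mathcal{E}q\rangle_{L^2(\Omega)}\le b$. Define $j_{WI}:L^2(\Omega)\to\mathbb{R}\cup\{+\infty\}$ by $$j_{WI}(q)=\frac12\|\mathcal{E}q-\overline{\psi}\|_{L^2(\Omega)}^2+\frac{\alpha}{2}\|q\|_{L^2(\Omega)}^2+I_{[a,b]}\big(\langle w,\mathcal{E}q\rangle_{L^2(\Omega)}\big).$$ Then $q^*\in L^2(\Omega)$ is a global minimizer of $j_{WI}$ if and only if $$0\in\big\{\mathcal{E}^*(\mathcal{E}q^*-\overline{\psi})+\alpha q^*\big\}+N^C_{[a,b]}\big(\langle w,\mathcal{E}q^*\rangle_{L^2(\Omega)}\big)\cdot\mathcal{E}^*w .$$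
   Context: For a set $S$, $I_S(x)=0$ if $x\in S$ and $I_S(x)=+\infty$ otherwise. For $t\in[a,b]$, the normal cone is $N^C_{[a,b]}(t)=\{0\}$ if $a<t<b$, $(-\infty,0]$ if $t=a$, and $[0,+\infty)$ if $t=b$; for $t\notin[a,b]$ it is empty. For $N\subseteq\mathbb{R}$ and $g\in L^2(\Omega)$, $N\cdot g=\{rg: r\in N\}\subseteq L^2(\Omega)$ (empty if $N$ is empty), and sums of sets are Minkowski sums. *)

theory Defs
  imports "HOL-Analysis.Analysis"
begin

section \<open>The space of square-integrable functions modulo almost-everywhere equality\<close>

text \<open>
  Elements of \<open>L2 \<Omega>\<close> are equivalence classes. A representative is a total function on the
  ambient space, but both conditions below refer to \<open>lebesgue_on \<Omega>\<close> only, so its values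
  outside \<open>\<Omega>\<close> play no role.
\<close>

definition square_integrable :: "(real ^ 'n) set \<Rightarrow> (real ^ 'n \<Rightarrow> real) set" where
  "square_integrable \<Omega> =
     {f. f \<in> borel_measurable (lebesgue_on \<Omega>) \<and> integrable (lebesgue_on \<Omega>) (\<lambda>x. (f x)\<^sup>2)}"

definition ae_eq_rel :: "(real ^ 'n) set \<Rightarrow> (real ^ 'n \<Rightarrow> real) rel" where
  "ae_eq_rel \<Omega> = {(f, g). f \<in> square_integrable \<Omega> \<and> g \<in> square_integrable \<Omega> \<and>
                            (AE x in lebesgue_on \<Omega>. f x = g x)}"

type_synonym 'n l2_elem = "(real ^ 'n \<Rightarrow> real) set"

definition L2 :: "(real ^ 'n) set \<Rightarrow> 'n l2_elem set" where
  "L2 \<Omega> = square_integrable \<Omega> // ae_eq_rel \<Omega>"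

definition L2_class :: "(real ^ 'n) set \<Rightarrow> (real ^ 'n \<Rightarrow> real) \<Rightarrow> 'n l2_elem" where
  "L2_class \<Omega> f = ae_eq_rel \<Omega> `` {f}"

text \<open>
  The operations below use an arbitrary representative; the lemmas
  \<open>L2_add_class\<close>, \<open>L2_diff_class\<close>, \<open>L2_scale_class\<close>, \<open>L2_inner_class\<close> and \<open>L2_norm_class\<close>
  show that the choice is irrelevant.
\<close>

definition L2_rep :: "'n::finite l2_elem \<Rightarrow> real ^ 'n \<Rightarrow> real" where
  "L2_rep F = (SOME f. f \<in> F)"

definition L2_zero :: "(real ^ 'n) set \<Rightarrow> 'n l2_elem" where
  "L2_zero \<Omega> = L2_class \<Omega> (\<lambda>_. 0)"

definition L2_add :: "(real ^ 'n) set \<Rightarrow> 'n l2_elem \<Rightarrow> 'n l2_elem \<Rightarrow> 'n l2_elem" where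
  "L2_add \<Omega> F G = L2_class \<Omega> (\<lambda>x. L2_rep F x + L2_rep G x)"

definition L2_diff :: "(real ^ 'n) set \<Rightarrow> 'n l2_elem \<Rightarrow> 'n l2_elem \<Rightarrow> 'n l2_elem" where
  "L2_diff \<Omega> F G = L2_class \<Omega> (\<lambda>x. L2_rep F x - L2_rep G x)"

definition L2_scale :: "(real ^ 'n) set \<Rightarrow> real \<Rightarrow> 'n l2_elem \<Rightarrow> 'n l2_elem" where
  "L2_scale \<Omega> r F = L2_class \<Omega> (\<lambda>x. r * L2_rep F x)"

definition L2_inner :: "(real ^ 'n) set \<Rightarrow> 'n l2_elem \<Rightarrow> 'n l2_elem \<Rightarrow> real" where
  "L2_inner \<Omega> F G = (LINT x|lebesgue_on \<Omega>. L2_rep F x * L2_rep G x)"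

definition L2_norm :: "(real ^ 'n) set \<Rightarrow> 'n l2_elem \<Rightarrow> real" where
  "L2_norm \<Omega> F = sqrt (L2_inner \<Omega> F F)"

lemma equiv_ae_eq_rel: "equiv (square_integrable \<Omega>) (ae_eq_rel \<Omega>)"
proof (rule equivI)
  show "ae_eq_rel \<Omega> \<subseteq> square_integrable \<Omega> \<times> square_integrable \<Omega>"
    by (auto simp: ae_eq_rel_def)
  show "refl_on (square_integrable \<Omega>) (ae_eq_rel \<Omega>)"
    by (auto simp: refl_on_def ae_eq_rel_def)
  show "sym (ae_eq_rel \<Omega>)"
    by (auto simp: sym_def ae_eq_rel_def elim: eventually_mono)
  show "trans (ae_eq_rel \<Omega>)"
    unfolding trans_def ae_eq_rel_def by (auto elim: eventually_elim2)
qed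

lemma L2_class_eq_iff:
  assumes "f \<in> square_integrable \<Omega>" "g \<in> square_integrable \<Omega>"
  shows "L2_class \<Omega> f = L2_class \<Omega> g \<longleftrightarrow> (AE x in lebesgue_on \<Omega>. f x = g x)"
  unfolding L2_class_def
  using eq_equiv_class_iff[OF equiv_ae_eq_rel assms] assms by (auto simp: ae_eq_rel_def)

lemma L2_class_in: "f \<in> square_integrable \<Omega> \<Longrightarrow> L2_class \<Omega> f \<in> L2 \<Omega>"
  unfolding L2_class_def L2_def by (rule quotientI)

lemma L2_rep_class:
  assumes "f \<in> square_integrable \<Omega>"
  shows "L2_rep (L2_class \<Omega> f) \<in> square_integrable \<Omega>"
    and "AE x in lebesgue_on \<Omega>. L2_rep (L2_class \<Omega> f) x = f x"
proof -
  have "f \<in> L2_class \<Omega> f"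
    unfolding L2_class_def using assms by (rule equiv_class_self[OF equiv_ae_eq_rel])
  then have "L2_rep (L2_class \<Omega> f) \<in> L2_class \<Omega> f"
    unfolding L2_rep_def by (rule someI[where P = "\<lambda>g. g \<in> L2_class \<Omega> f"])
  then have "(f, L2_rep (L2_class \<Omega> f)) \<in> ae_eq_rel \<Omega>"
    by (simp add: L2_class_def)
  then show "L2_rep (L2_class \<Omega> f) \<in> square_integrable \<Omega>"
    and "AE x in lebesgue_on \<Omega>. L2_rep (L2_class \<Omega> f) x = f x"
    by (auto simp: ae_eq_rel_def elim: eventually_mono)
qed

lemma L2_cases:
  assumes "F \<in> L2 \<Omega>"
  obtains f where "f \<in> square_integrable \<Omega>" "F = L2_class \<Omega> f"
  using assms unfolding L2_def L2_class_def by (rule quotientE)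

lemma square_integrable_mult:
  assumes "f \<in> square_integrable \<Omega>" "g \<in> square_integrable \<Omega>"
  shows "integrable (lebesgue_on \<Omega>) (\<lambda>x. f x * g x)"
proof (rule Bochner_Integration.integrable_bound)
  show "integrable (lebesgue_on \<Omega>) (\<lambda>x. (f x)\<^sup>2 + (g x)\<^sup>2)"
    using assms by (auto simp: square_integrable_def)
  show "(\<lambda>x. f x * g x) \<in> borel_measurable (lebesgue_on \<Omega>)"
    using assms by (auto simp: square_integrable_def)
  have "\<bar>u * v\<bar> \<le> u\<^sup>2 + v\<^sup>2" for u v :: real
  proof -
    have "2 * (\<bar>u\<bar> * \<bar>v\<bar>) \<le> u\<^sup>2 + v\<^sup>2"
      using sum_squares_bound[of "\<bar>u\<bar>" "\<bar>v\<bar>"] by simp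
    moreover have "0 \<le> \<bar>u\<bar> * \<bar>v\<bar>" by simp
    ultimately show ?thesis unfolding abs_mult by linarith
  qed
  then show "AE x in lebesgue_on \<Omega>. norm (f x * g x) \<le> norm ((f x)\<^sup>2 + (g x)\<^sup>2)"
    by simp
qed

lemma square_integrable_zero: "(\<lambda>_. 0) \<in> square_integrable \<Omega>"
  by (simp add: square_integrable_def)

lemma square_integrable_scale:
  "f \<in> square_integrable \<Omega> \<Longrightarrow> (\<lambda>x. r * f x) \<in> square_integrable \<Omega>"
  by (auto simp: square_integrable_def power_mult_distrib)

lemma square_integrable_add:
  assumes "f \<in> square_integrable \<Omega>" "g \<in> square_integrable \<Omega>"
  shows "(\<lambda>x. f x + g x) \<in> square_integrable \<Omega>"
  using assms square_integrable_mult[OF assms]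
  by (auto simp: square_integrable_def power2_sum mult.assoc)

lemma square_integrable_diff:
  assumes "f \<in> square_integrable \<Omega>" "g \<in> square_integrable \<Omega>"
  shows "(\<lambda>x. f x - g x) \<in> square_integrable \<Omega>"
  using square_integrable_add[OF assms(1) square_integrable_scale[OF assms(2), of "-1"]] by simp

lemma L2_add_class:
  assumes "f \<in> square_integrable \<Omega>" "g \<in> square_integrable \<Omega>"
  shows "L2_add \<Omega> (L2_class \<Omega> f) (L2_class \<Omega> g) = L2_class \<Omega> (\<lambda>x. f x + g x)"
proof -
  have "AE x in lebesgue_on \<Omega>. L2_rep (L2_class \<Omega> f) x + L2_rep (L2_class \<Omega> g) x = f x + g x"
    using L2_rep_class(2)[OF assms(1)] L2_rep_class(2)[OF assms(2)] by eventually_elim simp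
  then show ?thesis
    unfolding L2_add_def
    by (subst L2_class_eq_iff) (auto intro!: square_integrable_add L2_rep_class assms)
qed

lemma L2_diff_class:
  assumes "f \<in> square_integrable \<Omega>" "g \<in> square_integrable \<Omega>"
  shows "L2_diff \<Omega> (L2_class \<Omega> f) (L2_class \<Omega> g) = L2_class \<Omega> (\<lambda>x. f x - g x)"
proof -
  have "AE x in lebesgue_on \<Omega>. L2_rep (L2_class \<Omega> f) x - L2_rep (L2_class \<Omega> g) x = f x - g x"
    using L2_rep_class(2)[OF assms(1)] L2_rep_class(2)[OF assms(2)] by eventually_elim simp
  then show ?thesis
    unfolding L2_diff_def
    by (subst L2_class_eq_iff) (auto intro!: square_integrable_diff L2_rep_class assms)
qed

lemma L2_scale_class:
  assumes "f \<in> square_integrable \<Omega>"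
  shows "L2_scale \<Omega> r (L2_class \<Omega> f) = L2_class \<Omega> (\<lambda>x. r * f x)"
proof -
  have "AE x in lebesgue_on \<Omega>. r * L2_rep (L2_class \<Omega> f) x = r * f x"
    using L2_rep_class(2)[OF assms(1)] by eventually_elim simp
  then show ?thesis
    unfolding L2_scale_def
    by (subst L2_class_eq_iff) (auto intro!: square_integrable_scale L2_rep_class assms)
qed

lemma L2_inner_class:
  assumes "f \<in> square_integrable \<Omega>" "g \<in> square_integrable \<Omega>"
  shows "L2_inner \<Omega> (L2_class \<Omega> f) (L2_class \<Omega> g) = (LINT x|lebesgue_on \<Omega>. f x * g x)"
  unfolding L2_inner_def
proof (rule integral_cong_AE)
  show "AE x in lebesgue_on \<Omega>. L2_rep (L2_class \<Omega> f) x * L2_rep (L2_class \<Omega> g) x = f x * g x"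
    using L2_rep_class(2)[OF assms(1)] L2_rep_class(2)[OF assms(2)] by eventually_elim simp
qed (use assms L2_rep_class(1)[OF assms(1)] L2_rep_class(1)[OF assms(2)]
      in \<open>auto simp: square_integrable_def\<close>)

lemma L2_norm_class:
  assumes "f \<in> square_integrable \<Omega>"
  shows "L2_norm \<Omega> (L2_class \<Omega> f) = sqrt (LINT x|lebesgue_on \<Omega>. (f x)\<^sup>2)"
  by (simp add: L2_norm_def L2_inner_class assms power2_eq_square)


section \<open>Operators and sets in the space\<close>

definition L2_bounded_linear :: "(real ^ 'n) set \<Rightarrow> ('n l2_elem \<Rightarrow> 'n l2_elem) \<Rightarrow> bool" where
  "L2_bounded_linear \<Omega> T \<longleftrightarrow>
     (\<forall>p\<in>L2 \<Omega>. T p \<in> L2 \<Omega>) \<and>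
     (\<forall>p\<in>L2 \<Omega>. \<forall>q\<in>L2 \<Omega>. T (L2_add \<Omega> p q) = L2_add \<Omega> (T p) (T q)) \<and>
     (\<forall>r. \<forall>p\<in>L2 \<Omega>. T (L2_scale \<Omega> r p) = L2_scale \<Omega> r (T p)) \<and>
     (\<exists>K. \<forall>p\<in>L2 \<Omega>. L2_norm \<Omega> (T p) \<le> K * L2_norm \<Omega> p)"

text \<open>\<open>L2_adjoint \<Omega> T T'\<close> determines \<open>T'\<close> uniquely on \<open>L2 \<Omega>\<close>.\<close>

definition L2_adjoint ::
  "(real ^ 'n) set \<Rightarrow> ('n l2_elem \<Rightarrow> 'n l2_elem) \<Rightarrow> ('n l2_elem \<Rightarrow> 'n l2_elem) \<Rightarrow> bool" where
  "L2_adjoint \<Omega> T T' \<longleftrightarrow>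
     (\<forall>q\<in>L2 \<Omega>. T' q \<in> L2 \<Omega>) \<and>
     (\<forall>p\<in>L2 \<Omega>. \<forall>q\<in>L2 \<Omega>. L2_inner \<Omega> (T p) q = L2_inner \<Omega> p (T' q))"

definition L2_minkowski_sum ::
  "(real ^ 'n) set \<Rightarrow> 'n l2_elem set \<Rightarrow> 'n l2_elem set \<Rightarrow> 'n l2_elem set" where
  "L2_minkowski_sum \<Omega> A B = {L2_add \<Omega> p q | p q. p \<in> A \<and> q \<in> B}"

definition L2_set_scale :: "(real ^ 'n) set \<Rightarrow> real set \<Rightarrow> 'n l2_elem \<Rightarrow> 'n l2_elem set" where
  "L2_set_scale \<Omega> N g = {L2_scale \<Omega> r g | r. r \<in> N}"


section \<open>The constrained objective functional\<close>

text \<open>The indicator of convex analysis, as opposed to the \<open>0\<close>-\<open>1\<close> valued \<open>indicator\<close>.\<close>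

definition convex_indicator :: "'a set \<Rightarrow> 'a \<Rightarrow> ereal" where
  "convex_indicator S x = (if x \<in> S then 0 else \<infinity>)"

definition normal_cone_interval :: "real \<Rightarrow> real \<Rightarrow> real \<Rightarrow> real set" where
  "normal_cone_interval a b t =
     (if a < t \<and> t < b then {0}
      else if t = a then {..0}
      else if t = b then {0..}
      else {})"

definition j_WI ::
  "(real ^ 'n) set \<Rightarrow> ('n l2_elem \<Rightarrow> 'n l2_elem) \<Rightarrow> 'n l2_elem \<Rightarrow> 'n l2_elem \<Rightarrow>
   real \<Rightarrow> real \<Rightarrow> real \<Rightarrow> 'n l2_elem \<Rightarrow> ereal" where
  "j_WI \<Omega> \<E> \<psi> w \<alpha> a b q =
     ereal (1/2 * (L2_norm \<Omega> (L2_diff \<Omega> (\<E> q) \<psi>))\<^sup>2 + \<alpha>/2 * (L2_norm \<Omega> q)\<^sup>2)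
     + convex_indicator {a..b} (L2_inner \<Omega> w (\<E> q))"

end

theory Submission
  imports Defs
begin

text \<open>
  The smooth part \<open>J\<close> of the objective is a convex quadratic with gradient
  \<open>G = \<E>\<^sup>* (\<E> q - \<psi>) + \<alpha> q\<close>, and the constraint is \<open>a \<le> \<langle>g, q\<rangle> \<le> b\<close> with \<open>g = \<E>\<^sup>* w\<close>.
  If \<open>G + r g = 0\<close> with \<open>r\<close> in the normal cone, then \<open>J p - J q \<ge> \<langle>G, p - q\<rangle> = - r \<langle>g, p - q\<rangle> \<ge> 0\<close>
  for every feasible \<open>p\<close>. Conversely, at a minimizer \<open>\<langle>G, h\<rangle> \<ge> 0\<close> for every feasible direction
  \<open>h\<close>. Taking \<open>h\<close> to be minus the component of \<open>G\<close> orthogonal to \<open>g\<close> shows \<open>G = c g\<close>, and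
  \<open>h = - g\<close> or \<open>h = g\<close>, whichever is feasible, determines the sign of \<open>c\<close>.
\<close>

section \<open>Closure, bilinearity and definiteness of the inner product on classes\<close>

lemma L2_add_closed [simp]: "F \<in> L2 \<Omega> \<Longrightarrow> G \<in> L2 \<Omega> \<Longrightarrow> L2_add \<Omega> F G \<in> L2 \<Omega>"
  by (auto elim!: L2_cases simp: L2_add_class intro!: L2_class_in square_integrable_add)

lemma L2_diff_closed [simp]: "F \<in> L2 \<Omega> \<Longrightarrow> G \<in> L2 \<Omega> \<Longrightarrow> L2_diff \<Omega> F G \<in> L2 \<Omega>"
  by (auto elim!: L2_cases simp: L2_diff_class intro!: L2_class_in square_integrable_diff)

lemma L2_scale_closed [simp]: "F \<in> L2 \<Omega> \<Longrightarrow> L2_scale \<Omega> r F \<in> L2 \<Omega>"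
  by (auto elim!: L2_cases simp: L2_scale_class intro!: L2_class_in square_integrable_scale)

lemma L2_zero_closed [simp]: "L2_zero \<Omega> \<in> L2 \<Omega>"
  unfolding L2_zero_def by (intro L2_class_in square_integrable_zero)

lemma L2_inner_commute: "L2_inner \<Omega> F G = L2_inner \<Omega> G F"
  by (simp add: L2_inner_def mult.commute)

lemma L2_inner_add_left:
  assumes "F \<in> L2 \<Omega>" "G \<in> L2 \<Omega>" "H \<in> L2 \<Omega>"
  shows "L2_inner \<Omega> (L2_add \<Omega> F G) H = L2_inner \<Omega> F H + L2_inner \<Omega> G H"
  using assms
  by (auto elim!: L2_cases simp: L2_add_class L2_inner_class square_integrable_add
      square_integrable_mult distrib_right)

lemma L2_inner_diff_left:
  assumes "F \<in> L2 \<Omega>" "G \<in> L2 \<Omega>" "H \<in> L2 \<Omega>"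
  shows "L2_inner \<Omega> (L2_diff \<Omega> F G) H = L2_inner \<Omega> F H - L2_inner \<Omega> G H"
  using assms
  by (auto elim!: L2_cases simp: L2_diff_class L2_inner_class square_integrable_diff
      square_integrable_mult left_diff_distrib)

lemma L2_inner_scale_left:
  assumes "F \<in> L2 \<Omega>" "G \<in> L2 \<Omega>"
  shows "L2_inner \<Omega> (L2_scale \<Omega> r F) G = r * L2_inner \<Omega> F G"
  using assms
  by (auto elim!: L2_cases simp: L2_scale_class L2_inner_class square_integrable_scale mult.assoc)

lemma L2_inner_add_right:
  assumes "F \<in> L2 \<Omega>" "G \<in> L2 \<Omega>" "H \<in> L2 \<Omega>"
  shows "L2_inner \<Omega> H (L2_add \<Omega> F G) = L2_inner \<Omega> H F + L2_inner \<Omega> H G"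
  by (metis L2_inner_add_left L2_inner_commute assms)

lemma L2_inner_diff_right:
  assumes "F \<in> L2 \<Omega>" "G \<in> L2 \<Omega>" "H \<in> L2 \<Omega>"
  shows "L2_inner \<Omega> H (L2_diff \<Omega> F G) = L2_inner \<Omega> H F - L2_inner \<Omega> H G"
  by (metis L2_inner_diff_left L2_inner_commute assms)

lemma L2_inner_scale_right:
  assumes "F \<in> L2 \<Omega>" "G \<in> L2 \<Omega>"
  shows "L2_inner \<Omega> G (L2_scale \<Omega> r F) = r * L2_inner \<Omega> G F"
  by (metis L2_inner_scale_left L2_inner_commute assms)

lemmas L2_inner_bilinear =
  L2_inner_add_left L2_inner_diff_left L2_inner_scale_left
  L2_inner_add_right L2_inner_diff_right L2_inner_scale_right

lemma L2_inner_ge_0 [simp]: "0 \<le> L2_inner \<Omega> F F"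
  by (simp add: L2_inner_def)

lemma L2_norm_power2: "(L2_norm \<Omega> F)\<^sup>2 = L2_inner \<Omega> F F"
  by (simp add: L2_norm_def)

text \<open>The difference is never identified with a multiple of \<open>H\<close> as a class:
  expanding the inner product bilinearly makes every term containing \<open>F\<close> cancel. This
  supplies the second-order terms along a line through \<open>F\<close>.\<close>

lemma L2_norm_diff_add_scale_power2:
  assumes "F \<in> L2 \<Omega>" "H \<in> L2 \<Omega>"
  shows "(L2_norm \<Omega> (L2_diff \<Omega> (L2_add \<Omega> F (L2_scale \<Omega> s H)) F))\<^sup>2 = s\<^sup>2 * (L2_norm \<Omega> H)\<^sup>2"
  using assms unfolding L2_norm_power2 power2_eq_square[of s]
  by (simp add: L2_inner_bilinear algebra_simps)

text \<open>A nonnegative integrand with zero integral vanishes almost everywhere, and for classes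
  this is equality with zero.\<close>

lemma L2_inner_eq_0_iff:
  assumes "F \<in> L2 \<Omega>"
  shows "L2_inner \<Omega> F F = 0 \<longleftrightarrow> F = L2_zero \<Omega>"
proof -
  obtain f where f: "f \<in> square_integrable \<Omega>" "F = L2_class \<Omega> f"
    using assms by (rule L2_cases)
  have "L2_inner \<Omega> F F = 0 \<longleftrightarrow> (AE x in lebesgue_on \<Omega>. f x * f x = 0)"
    using f by (simp add: L2_inner_class square_integrable_mult integral_nonneg_eq_0_iff_AE)
  also have "\<dots> \<longleftrightarrow> F = L2_zero \<Omega>"
    using f by (simp add: L2_zero_def L2_class_eq_iff square_integrable_zero)
  finally show ?thesis .
qed

lemma L2_inner_zero_left: "F \<in> L2 \<Omega> \<Longrightarrow> L2_inner \<Omega> (L2_zero \<Omega>) F = 0"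
  by (auto elim!: L2_cases simp: L2_zero_def L2_inner_class square_integrable_zero)

section \<open>Reduction to a real-valued problem under a scalar constraint\<close>

lemma j_WI_feasible:
  assumes "a \<le> L2_inner \<Omega> w (\<E> q)" "L2_inner \<Omega> w (\<E> q) \<le> b"
  shows "j_WI \<Omega> \<E> \<psi> w \<alpha> a b q =
    ereal (1/2 * (L2_norm \<Omega> (L2_diff \<Omega> (\<E> q) \<psi>))\<^sup>2 + \<alpha>/2 * (L2_norm \<Omega> q)\<^sup>2)"
  using assms by (simp add: j_WI_def convex_indicator_def)

lemma j_WI_infeasible:
  assumes "\<not> (a \<le> L2_inner \<Omega> w (\<E> q) \<and> L2_inner \<Omega> w (\<E> q) \<le> b)"
  shows "j_WI \<Omega> \<E> \<psi> w \<alpha> a b q = \<infinity>"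
  using assms by (auto simp: j_WI_def convex_indicator_def)

text \<open>A feasible point has a finite value, so a point of value \<open>\<infinity>\<close>
  cannot be a minimizer; among feasible points the indicator vanishes and only the real cost is
  compared.\<close>

lemma is_arg_min_j_WI_iff:
  fixes \<E> :: "'n::finite l2_elem \<Rightarrow> 'n l2_elem" and \<psi> :: "'n l2_elem" and \<alpha> :: real
  assumes "\<exists>q\<in>L2 \<Omega>. a \<le> L2_inner \<Omega> w (\<E> q) \<and> L2_inner \<Omega> w (\<E> q) \<le> b" and "qs \<in> L2 \<Omega>"
  defines "J \<equiv> \<lambda>q. 1/2 * (L2_norm \<Omega> (L2_diff \<Omega> (\<E> q) \<psi>))\<^sup>2 + \<alpha>/2 * (L2_norm \<Omega> q)\<^sup>2"
  shows "is_arg_min (j_WI \<Omega> \<E> \<psi> w \<alpha> a b) (\<lambda>q. q \<in> L2 \<Omega>) qs \<longleftrightarrow>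
    a \<le> L2_inner \<Omega> w (\<E> qs) \<and> L2_inner \<Omega> w (\<E> qs) \<le> b \<and>
    (\<forall>q\<in>L2 \<Omega>. a \<le> L2_inner \<Omega> w (\<E> q) \<and> L2_inner \<Omega> w (\<E> q) \<le> b \<longrightarrow> J qs \<le> J q)"
    (is "?min \<longleftrightarrow> ?lo qs \<and> ?hi qs \<and> ?opt")
proof -
  have J: "j_WI \<Omega> \<E> \<psi> w \<alpha> a b q = (if ?lo q \<and> ?hi q then ereal (J q) else \<infinity>)" for q
    by (simp add: J_def j_WI_feasible j_WI_infeasible)
  obtain q0 where q0: "q0 \<in> L2 \<Omega>" "?lo q0 \<and> ?hi q0"
    using assms(1) by blast
  have min: "?min \<longleftrightarrow> (\<forall>q\<in>L2 \<Omega>. j_WI \<Omega> \<E> \<psi> w \<alpha> a b qs \<le> j_WI \<Omega> \<E> \<psi> w \<alpha> a b q)"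
    using assms(2) by (auto simp: is_arg_min_def not_less)
  show ?thesis
  proof (cases "?lo qs \<and> ?hi qs")
    case True
    then show ?thesis unfolding min J by auto
  next
    case False
    then have "\<not> ?min" unfolding min J using q0 by auto
    with False show ?thesis by blast
  qed
qed

section \<open>Expansion of the cost and the first-order test\<close>

text \<open>The exact second-order Taylor expansion at \<open>p\<close>: the cost is quadratic, so
  there is no further remainder, and the adjoint turns the cross term of the residual into a pairing
  with the gradient \<open>G\<close>.\<close>

lemma tracking_cost_diff:
  fixes \<E> \<E>s :: "'n::finite l2_elem \<Rightarrow> 'n l2_elem" and \<psi> :: "'n l2_elem" and \<alpha> :: real
  assumes \<E>: "\<And>q. q \<in> L2 \<Omega> \<Longrightarrow> \<E> q \<in> L2 \<Omega>" and adj: "L2_adjoint \<Omega> \<E> \<E>s"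
    and "\<psi> \<in> L2 \<Omega>" "p \<in> L2 \<Omega>" "q \<in> L2 \<Omega>"
  defines "J \<equiv> \<lambda>q. 1/2 * (L2_norm \<Omega> (L2_diff \<Omega> (\<E> q) \<psi>))\<^sup>2 + \<alpha>/2 * (L2_norm \<Omega> q)\<^sup>2"
  defines "G \<equiv> L2_add \<Omega> (\<E>s (L2_diff \<Omega> (\<E> p) \<psi>)) (L2_scale \<Omega> \<alpha> p)"
  shows "J q = J p + L2_inner \<Omega> G (L2_diff \<Omega> q p)
    + 1/2 * (L2_norm \<Omega> (L2_diff \<Omega> (\<E> q) (\<E> p)))\<^sup>2 + \<alpha>/2 * (L2_norm \<Omega> (L2_diff \<Omega> q p))\<^sup>2"
proof -
  have cl: "\<E> p \<in> L2 \<Omega>" "\<E> q \<in> L2 \<Omega>" "\<E>s (L2_diff \<Omega> (\<E> p) \<psi>) \<in> L2 \<Omega>"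
    using adj assms by (auto simp: L2_adjoint_def)
  have "L2_inner \<Omega> (\<E>s (L2_diff \<Omega> (\<E> p) \<psi>)) h = L2_inner \<Omega> (L2_diff \<Omega> (\<E> p) \<psi>) (\<E> h)"
    if "h \<in> L2 \<Omega>" for h
    using adj that cl assms(3) unfolding L2_adjoint_def by (metis L2_diff_closed L2_inner_commute)
  \<comment> \<open>Applying the adjoint identity to \<open>q\<close> and to \<open>p\<close> leaves
    only products of \<open>\<E> p\<close>, \<open>\<E> q\<close>, \<open>\<psi>\<close>,
    \<open>p\<close> and \<open>q\<close>; the symmetry instances bring each mixed product to one
    order so that the terms cancel.\<close>
  then show ?thesis
    using assms(3-5) cl unfolding J_def G_def
    by (simp add: L2_norm_power2 L2_inner_bilinear algebra_simps add_divide_distrib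
        diff_divide_distrib L2_inner_commute[of \<Omega> \<psi> "\<E> p"]
        L2_inner_commute[of \<Omega> \<psi> "\<E> q"] L2_inner_commute[of \<Omega> q p]
        L2_inner_commute[of \<Omega> "\<E> q" "\<E> p"])
qed

text \<open>Divide by \<open>s\<close> and let \<open>s\<close> tend to 0 from the right.\<close>

lemma first_order_coeff_nonneg:
  fixes m k \<delta> :: real
  assumes "\<delta> > 0" and ge: "\<And>s. 0 < s \<Longrightarrow> s < \<delta> \<Longrightarrow> 0 \<le> s * m + s\<^sup>2 * k"
  shows "0 \<le> m"
proof (rule tendsto_lowerbound)
  have "((\<lambda>s. m + s * k) \<longlongrightarrow> m + 0 * k) (at_right 0)"
    by (intro tendsto_intros)
  then show "((\<lambda>s. m + s * k) \<longlongrightarrow> m) (at_right 0)" by simp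
  have "0 \<le> m + s * k" if "0 < s" "s < \<delta>" for s
  proof -
    have "0 \<le> s * (m + s * k)"
      using ge[OF that] by (simp add: algebra_simps power2_eq_square)
    with that show ?thesis by (simp add: zero_le_mult_iff)
  qed
  then show "\<forall>\<^sub>F s in at_right 0. 0 \<le> m + s * k"
    using assms(1) unfolding eventually_at_right_field by blast
qed simp

section \<open>Equivalence of minimality and existence of a multiplier in the normal cone\<close>

theorem proposition4p2:
  fixes \<Omega> :: "(real ^ 'n) set"
    and \<psi> w qs :: "'n l2_elem"
    and \<E> \<E>s :: "'n l2_elem \<Rightarrow> 'n l2_elem"
    and \<alpha> a b :: real
  assumes "open \<Omega>" and "connected \<Omega>" and "\<Omega> \<noteq> {}" and "convex \<Omega>" and "bounded \<Omega>"
    and "\<psi> \<in> L2 \<Omega>" and "w \<in> L2 \<Omega>" and "\<alpha> > 0" and "a < b"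
    and "L2_bounded_linear \<Omega> \<E>" and "L2_adjoint \<Omega> \<E> \<E>s"
    and "\<exists>q\<in>L2 \<Omega>. a \<le> L2_inner \<Omega> w (\<E> q) \<and> L2_inner \<Omega> w (\<E> q) \<le> b"
    and "qs \<in> L2 \<Omega>"
  shows "is_arg_min (j_WI \<Omega> \<E> \<psi> w \<alpha> a b) (\<lambda>q. q \<in> L2 \<Omega>) qs \<longleftrightarrow>
    L2_zero \<Omega> \<in> L2_minkowski_sum \<Omega>
      {L2_add \<Omega> (\<E>s (L2_diff \<Omega> (\<E> qs) \<psi>)) (L2_scale \<Omega> \<alpha> qs)}
      (L2_set_scale \<Omega> (normal_cone_interval a b (L2_inner \<Omega> w (\<E> qs))) (\<E>s w))"
proof -
  have \<E>: "\<E> q \<in> L2 \<Omega>" if "q \<in> L2 \<Omega>" for q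
    using assms(10) that by (simp add: L2_bounded_linear_def)
  have \<E>s: "\<E>s q \<in> L2 \<Omega>" if "q \<in> L2 \<Omega>" for q
    using assms(11) that by (simp add: L2_adjoint_def)
  define J where
    "J = (\<lambda>q. 1/2 * (L2_norm \<Omega> (L2_diff \<Omega> (\<E> q) \<psi>))\<^sup>2 + \<alpha>/2 * (L2_norm \<Omega> q)\<^sup>2)"
  define G where "G = L2_add \<Omega> (\<E>s (L2_diff \<Omega> (\<E> qs) \<psi>)) (L2_scale \<Omega> \<alpha> qs)"
  define g where "g = \<E>s w"
  have cl [simp]: "qs \<in> L2 \<Omega>" "G \<in> L2 \<Omega>" "g \<in> L2 \<Omega>" "\<E> qs \<in> L2 \<Omega>"
    using assms(6,7,13) by (simp_all add: G_def g_def \<E> \<E>s)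
  have inner_w: "L2_inner \<Omega> w (\<E> q) = L2_inner \<Omega> g q" if "q \<in> L2 \<Omega>" for q
    using assms(7,11) that unfolding g_def L2_adjoint_def by (metis L2_inner_commute)
  have J_diff: "J q = J qs + L2_inner \<Omega> G (L2_diff \<Omega> q qs)
      + 1/2 * (L2_norm \<Omega> (L2_diff \<Omega> (\<E> q) (\<E> qs)))\<^sup>2 + \<alpha>/2 * (L2_norm \<Omega> (L2_diff \<Omega> q qs))\<^sup>2"
    if "q \<in> L2 \<Omega>" for q
    unfolding J_def G_def
    by (rule tracking_cost_diff) (use \<E> assms(6,11,13) that in auto)
  define t where "t = L2_inner \<Omega> g qs"
  have min_iff: "is_arg_min (j_WI \<Omega> \<E> \<psi> w \<alpha> a b) (\<lambda>q. q \<in> L2 \<Omega>) qs \<longleftrightarrow>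
      a \<le> t \<and> t \<le> b \<and>
      (\<forall>q\<in>L2 \<Omega>. a \<le> L2_inner \<Omega> g q \<and> L2_inner \<Omega> g q \<le> b \<longrightarrow> J qs \<le> J q)"
    using is_arg_min_j_WI_iff[OF assms(12,13), of \<psi> \<alpha>] by (simp add: inner_w J_def t_def)
  have "is_arg_min (j_WI \<Omega> \<E> \<psi> w \<alpha> a b) (\<lambda>q. q \<in> L2 \<Omega>) qs \<longleftrightarrow>
      (\<exists>r\<in>normal_cone_interval a b t. L2_add \<Omega> G (L2_scale \<Omega> r g) = L2_zero \<Omega>)"
  proof
    assume "is_arg_min (j_WI \<Omega> \<E> \<psi> w \<alpha> a b) (\<lambda>q. q \<in> L2 \<Omega>) qs"
    then have t: "a \<le> t" "t \<le> b"
      and opt: "\<And>q. q \<in> L2 \<Omega> \<Longrightarrow> a \<le> L2_inner \<Omega> g q \<Longrightarrow> L2_inner \<Omega> g q \<le> b \<Longrightarrow> J qs \<le> J q"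
      by (auto simp: min_iff)
    \<comment> \<open>Along a segment from \<open>qs\<close> in direction \<open>h\<close> that
      stays feasible, the cost increment is \<open>s\<close> times the slope plus
      \<open>s\<^sup>2\<close> times a constant, so minimality forces the slope to be
      nonnegative.\<close>
    have first_order: "0 \<le> L2_inner \<Omega> G h"
      if h: "h \<in> L2 \<Omega>" and "\<delta> > 0"
        and feas: "\<And>s. 0 < s \<Longrightarrow> s < \<delta> \<Longrightarrow> a \<le> t + s * L2_inner \<Omega> g h \<and> t + s * L2_inner \<Omega> g h \<le> b"
      for h \<delta>
    proof (rule first_order_coeff_nonneg[OF \<open>\<delta> > 0\<close>])
      fix s :: real
      assume s: "0 < s" "s < \<delta>"
      define q where "q = L2_add \<Omega> qs (L2_scale \<Omega> s h)"
      have q: "q \<in> L2 \<Omega>" using h by (simp add: q_def)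
      have \<E>q: "\<E> q = L2_add \<Omega> (\<E> qs) (L2_scale \<Omega> s (\<E> h))"
        using assms(10) h unfolding q_def L2_bounded_linear_def by simp
      have "L2_inner \<Omega> g q = t + s * L2_inner \<Omega> g h"
        using h by (simp add: q_def t_def L2_inner_bilinear)
      then have "J qs \<le> J q" using opt[OF q] feas[OF s] by simp
      then have "0 \<le> L2_inner \<Omega> G (L2_diff \<Omega> q qs)
          + 1/2 * (L2_norm \<Omega> (L2_diff \<Omega> (\<E> q) (\<E> qs)))\<^sup>2 + \<alpha>/2 * (L2_norm \<Omega> (L2_diff \<Omega> q qs))\<^sup>2"
        using J_diff[OF q] by simp
      also have "L2_inner \<Omega> G (L2_diff \<Omega> q qs) = s * L2_inner \<Omega> G h"
        using h by (simp add: q_def L2_inner_bilinear)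
      also have "(L2_norm \<Omega> (L2_diff \<Omega> (\<E> q) (\<E> qs)))\<^sup>2 = s\<^sup>2 * (L2_norm \<Omega> (\<E> h))\<^sup>2"
        using h by (simp add: \<E>q \<E> L2_norm_diff_add_scale_power2)
      also have "(L2_norm \<Omega> (L2_diff \<Omega> q qs))\<^sup>2 = s\<^sup>2 * (L2_norm \<Omega> h)\<^sup>2"
        using h by (simp add: q_def L2_norm_diff_add_scale_power2)
      finally show "0 \<le> s * L2_inner \<Omega> G h
          + s\<^sup>2 * (1/2 * (L2_norm \<Omega> (\<E> h))\<^sup>2 + \<alpha>/2 * (L2_norm \<Omega> h)\<^sup>2)"
        by (simp add: algebra_simps)
    qed
    \<comment> \<open>For \<open>g = 0\<close> the quotient is \<open>0\<close>, which is what is needed in that case.\<close>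
    define c where "c = L2_inner \<Omega> G g / L2_inner \<Omega> g g"
    \<comment> \<open>\<open>c\<close> times \<open>g\<close> is the projection of \<open>G\<close>
      onto the span of \<open>g\<close>, so \<open>h\<close> is the orthogonal remainder; once
      \<open>h\<close> vanishes, \<open>- c\<close> is the multiplier sought.\<close>
    define h where "h = L2_add \<Omega> G (L2_scale \<Omega> (- c) g)"
    have h: "h \<in> L2 \<Omega>" by (simp add: h_def)
    have Gg: "L2_inner \<Omega> G g = c * L2_inner \<Omega> g g"
    proof (cases "L2_inner \<Omega> g g = 0")
      \<comment> \<open>The default value of the quotient does not suffice here: the left side
        vanishes because definiteness gives \<open>g = 0\<close>.\<close>
      case True
      then show ?thesis
        by (metis L2_inner_commute L2_inner_eq_0_iff L2_inner_zero_left cl(2,3) mult_zero_right)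
    qed (simp add: c_def)
    then have gh: "L2_inner \<Omega> g h = 0"
      by (simp add: h_def L2_inner_bilinear L2_inner_commute[of \<Omega> g G])
    \<comment> \<open>Moving orthogonally to \<open>g\<close> keeps the constraint value at
      \<open>t\<close>, so any step length is feasible and 1 is an arbitrary choice.\<close>
    have "0 \<le> L2_inner \<Omega> G (L2_scale \<Omega> (-1) h)"
      by (rule first_order[of _ 1]) (use h t in \<open>simp_all add: L2_inner_bilinear gh\<close>)
    moreover have "L2_inner \<Omega> h h = L2_inner \<Omega> G h - c * L2_inner \<Omega> g h"
      using h by (subst (1) h_def) (simp add: L2_inner_bilinear)
    \<comment> \<open>By orthogonality the squared norm of \<open>h\<close> equals its pairing with
      \<open>G\<close>, which was just shown to be at most 0.\<close>
    ultimately have "L2_inner \<Omega> h h = 0"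
      using h L2_inner_ge_0[of \<Omega> h] by (simp add: L2_inner_bilinear gh)
    then have h0: "h = L2_zero \<Omega>" using h by (simp add: L2_inner_eq_0_iff)
    have c_le: "c \<le> 0" if "a < t"
    proof (cases "L2_inner \<Omega> g g = 0")
      case False
      then have pos: "0 < L2_inner \<Omega> g g" using L2_inner_ge_0[of \<Omega> g] by linarith
      have "0 \<le> L2_inner \<Omega> G (L2_scale \<Omega> (-1) g)"
      proof (rule first_order)
        \<comment> \<open>Along \<open>- g\<close> the constraint value falls at rate
          \<open>L2_inner \<Omega> g g\<close>, so the slack above \<open>a\<close> lasts for this
          step length.\<close>
        show "0 < (t - a) / L2_inner \<Omega> g g" using that pos by simp
        fix s assume "0 < s" "s < (t - a) / L2_inner \<Omega> g g"
        then have "s * L2_inner \<Omega> g g < t - a" "0 < s * L2_inner \<Omega> g g"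
          using pos by (simp_all add: pos_less_divide_eq)
        then show "a \<le> t + s * L2_inner \<Omega> g (L2_scale \<Omega> (-1) g)
            \<and> t + s * L2_inner \<Omega> g (L2_scale \<Omega> (-1) g) \<le> b"
          using t by (simp add: L2_inner_bilinear)
      qed simp
      then show ?thesis using pos by (simp add: L2_inner_bilinear Gg mult_le_0_iff)
    qed (simp add: c_def)
    have c_ge: "0 \<le> c" if "t < b"
    proof (cases "L2_inner \<Omega> g g = 0")
      case False
      then have pos: "0 < L2_inner \<Omega> g g" using L2_inner_ge_0[of \<Omega> g] by linarith
      have "0 \<le> L2_inner \<Omega> G g"
      proof (rule first_order)
        show "0 < (b - t) / L2_inner \<Omega> g g" using that pos by simp
        fix s assume "0 < s" "s < (b - t) / L2_inner \<Omega> g g"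
        then have "s * L2_inner \<Omega> g g < b - t" "0 < s * L2_inner \<Omega> g g"
          using pos by (simp_all add: pos_less_divide_eq)
        then show "a \<le> t + s * L2_inner \<Omega> g g \<and> t + s * L2_inner \<Omega> g g \<le> b"
          using t by simp
      qed simp
      then show ?thesis using pos by (simp add: Gg zero_le_mult_iff)
    qed (simp add: c_def)
    \<comment> \<open>In the interior both sign conditions apply and give \<open>c = 0\<close>; at
      an endpoint, \<open>a < b\<close> leaves room on the other side, which yields the one sign
      required.\<close>
    have "- c \<in> normal_cone_interval a b t"
      using c_le c_ge t \<open>a < b\<close> by (auto simp: normal_cone_interval_def)
    then show "\<exists>r\<in>normal_cone_interval a b t. L2_add \<Omega> G (L2_scale \<Omega> r g) = L2_zero \<Omega>"
      using h0 unfolding h_def by blast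
  next
    assume "\<exists>r\<in>normal_cone_interval a b t. L2_add \<Omega> G (L2_scale \<Omega> r g) = L2_zero \<Omega>"
    then obtain r where r: "r \<in> normal_cone_interval a b t"
      and zero: "L2_add \<Omega> G (L2_scale \<Omega> r g) = L2_zero \<Omega>" by blast
    \<comment> \<open>Feasibility is contained in the inclusion, since the normal cone is empty
      outside the interval.\<close>
    have "a \<le> t" "t \<le> b"
      using r \<open>a < b\<close> by (auto simp: normal_cone_interval_def split: if_splits)
    moreover have "J qs \<le> J q"
      if q: "q \<in> L2 \<Omega>" and feas: "a \<le> L2_inner \<Omega> g q" "L2_inner \<Omega> g q \<le> b" for q
    proof -
      have "L2_inner \<Omega> (L2_add \<Omega> G (L2_scale \<Omega> r g)) (L2_diff \<Omega> q qs) = 0"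
        using q by (simp add: zero L2_inner_zero_left)
      then have "L2_inner \<Omega> G (L2_diff \<Omega> q qs) = r * (t - L2_inner \<Omega> g q)"
        using q by (simp add: L2_inner_bilinear t_def algebra_simps)
      \<comment> \<open>Both factors are at most 0 when \<open>t = a\<close>, both are at least 0
        when \<open>t = b\<close>, and \<open>r = 0\<close> in between.\<close>
      also have "\<dots> \<ge> 0"
        using r feas \<open>a < b\<close>
        by (auto simp: normal_cone_interval_def zero_le_mult_iff split: if_splits)
      \<comment> \<open>The remaining terms of the expansion are nonnegative multiples of squares,
        so this first-order bound is a global one.\<close>
      finally show ?thesis
        using J_diff[OF q] \<open>\<alpha> > 0\<close> by simp
    qed
    ultimately show "is_arg_min (j_WI \<Omega> \<E> \<psi> w \<alpha> a b) (\<lambda>q. q \<in> L2 \<Omega>) qs"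
      by (simp add: min_iff)
  qed
  also have "\<dots> \<longleftrightarrow> L2_zero \<Omega> \<in> L2_minkowski_sum \<Omega> {G}
      (L2_set_scale \<Omega> (normal_cone_interval a b t) g)"
    unfolding L2_minkowski_sum_def L2_set_scale_def by force
  finally show ?thesis
    by (simp add: G_def g_def t_def inner_w)
qed

end
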